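(* Let $k$ be a field, $V$ a finite-dimensional $k$-vector space and $b:V\times V\to k$ an anisotropic symmetric $k$-bilinear form. Then for any $p\in\mathrm{PU}(b)^-$ there exist unique $k$-subspaces $U_i\subseteq V$ ($1\le i\le n$) and a unique $h\in U(b)$ such that $U_i^*+U_{i+1}=V$ ($1\le i<n$) and $$p=p_{U_1}p_{U_2}\cdots p_{U_n}h .$$
   Context: Here $n$ denotes the number of factors $p_{U_i}$ in the factorization (it is not the dimension of $V$). Anisotropic means $b(v,v)=0\Leftrightarrow v=0$. For a subspace $U\subseteq V$, $U^*=\{v\in V:b(u,v)=0\ \forall u\in U\}$; one has $V=U\oplus U^*$, and $\pi_U:V\to V$ denotes the projection onto $U$ along $U^*$. $U(b)$ is the group of $k$-linear maps $\varphi:V\to V$ with $b(\varphi(v),\varphi(w))=b(v,w)$ for all $v,w\in V$. Let $V[t,t^{-1}]:=k[t,t^{-1}]\otimes_k V$; its elements are finite sums $v=\sum_{i\in\mathbb Z}t^iv_i$ with $v_i\in V$. Define $\tilde b(v,w)=\sum_{n\in\mathbb Z} t^n\big(\sum_{i\in\mathbb Z} b(v_{i-n},w_i)\big)\in k[t,t^{-1}]$ (here $n$ is a summation index). Each $\varphi\in \mathrm{End}_{k[t,t^{-1}]}V[t,t^{-1}]$ is uniquely a finite sum $\varphi=\sum_i t^i\varphi_i$ with $\varphi_i\in\mathrm{End}_kV$. The paraunitary group $\mathrm{PU}(b)$ is the group of all invertible $k[t,t^{-1}]$-linear endomorphisms $\varphi$ of $V[t,t^{-1}]$ with $\tilde b(\varphi(v),\varphi(w))=\tilde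 b(v,w)$ for all $v,w$, and $\mathrm{PU}(b)^-$ is the submonoid of those $\varphi\in\mathrm{PU}(b)$ with $\varphi_i=0$ for all $i>0$. $U(b)$ is regarded as a subgroup of $\mathrm{PU}(b)$ via $\varphi\mapsto t^0\varphi$. For a subspace $U\subseteq V$ put $p_U:=t^{-1}\pi_{U^*}+\pi_U\in\mathrm{PU}(b)$. *)

theory Defs
  imports Complex_Main "HOL-Library.Poly_Mapping" "HOL-Library.Set_Algebras"
begin

text \<open>
  The type \<open>'v\<close> with scalar multiplication \<open>scale\<close> is the \<open>k\<close>-vector space \<open>V\<close>.
  Laurent polynomials are finitely supported functions on the integers: \<open>k[t,t\<^sup>-\<^sup>1]\<close> is the
  convolution ring \<open>int \<Rightarrow>\<^sub>0 'k\<close>, and \<open>v :: int \<Rightarrow>\<^sub>0 'v\<close> is the finite sum of the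
  \<open>t\<^sup>i v\<^sub>i\<close> with \<open>v\<^sub>i = lookup v i\<close>.
\<close>

definition symmetric_bilinear_form ::
    "('k::field \<Rightarrow> 'v::ab_group_add \<Rightarrow> 'v) \<Rightarrow> ('v \<Rightarrow> 'v \<Rightarrow> 'k) \<Rightarrow> bool" where
  "symmetric_bilinear_form scale b \<longleftrightarrow>
     (\<forall>v. Vector_Spaces.linear scale (*) (\<lambda>w. b v w)) \<and>
     (\<forall>w. Vector_Spaces.linear scale (*) (\<lambda>v. b v w)) \<and>
     (\<forall>v w. b v w = b w v)"

definition anisotropic :: "('v::zero \<Rightarrow> 'v \<Rightarrow> 'k::zero) \<Rightarrow> bool" where
  "anisotropic b \<longleftrightarrow> (\<forall>v. b v v = 0 \<longleftrightarrow> v = 0)"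

definition orth :: "('v \<Rightarrow> 'v \<Rightarrow> 'k::zero) \<Rightarrow> 'v set \<Rightarrow> 'v set" where
  "orth b U = {v. \<forall>u\<in>U. b u v = 0}"

definition orth_proj :: "('v::ab_group_add \<Rightarrow> 'v \<Rightarrow> 'k::zero) \<Rightarrow> 'v set \<Rightarrow> 'v \<Rightarrow> 'v" where
  "orth_proj b U v = (THE u. u \<in> U \<and> v - u \<in> orth b U)"

definition unitary_group ::
    "('k::field \<Rightarrow> 'v::ab_group_add \<Rightarrow> 'v) \<Rightarrow> ('v \<Rightarrow> 'v \<Rightarrow> 'k) \<Rightarrow> ('v \<Rightarrow> 'v) set" where
  "unitary_group scale b =
     {\<phi>. Vector_Spaces.linear scale scale \<phi> \<and> (\<forall>v w. b (\<phi> v) (\<phi> w) = b v w)}"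

definition laurent_scale ::
    "('k::field \<Rightarrow> 'v::ab_group_add \<Rightarrow> 'v) \<Rightarrow> (int \<Rightarrow>\<^sub>0 'k) \<Rightarrow> (int \<Rightarrow>\<^sub>0 'v) \<Rightarrow> (int \<Rightarrow>\<^sub>0 'v)" where
  "laurent_scale scale f v =
     (\<Sum>i\<in>Poly_Mapping.keys f. \<Sum>j\<in>Poly_Mapping.keys v.
        Poly_Mapping.single (i + j) (scale (Poly_Mapping.lookup f i) (Poly_Mapping.lookup v j)))"

definition laurent_form ::
    "('v::ab_group_add \<Rightarrow> 'v \<Rightarrow> 'k::field) \<Rightarrow> (int \<Rightarrow>\<^sub>0 'v) \<Rightarrow> (int \<Rightarrow>\<^sub>0 'v) \<Rightarrow> (int \<Rightarrow>\<^sub>0 'k)" where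
  "laurent_form b v w =
     (\<Sum>j\<in>Poly_Mapping.keys v. \<Sum>i\<in>Poly_Mapping.keys w.
        Poly_Mapping.single (i - j) (b (Poly_Mapping.lookup v j) (Poly_Mapping.lookup w i)))"

text \<open>The coefficient \<open>\<phi>\<^sub>i\<close> of a \<open>k[t,t\<^sup>-\<^sup>1]\<close>-linear \<open>\<phi>\<close>; see \<open>lookup_laurent_endo\<close> below.\<close>

definition endo_coeff ::
    "((int \<Rightarrow>\<^sub>0 'v::ab_group_add) \<Rightarrow> (int \<Rightarrow>\<^sub>0 'v)) \<Rightarrow> int \<Rightarrow> 'v \<Rightarrow> 'v" where
  "endo_coeff \<phi> i v = Poly_Mapping.lookup (\<phi> (Poly_Mapping.single 0 v)) i"

text \<open>The embedding \<open>f \<mapsto> t\<^sup>0 f\<close> of endomorphisms of \<open>V\<close> (coefficientwise application).\<close>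

abbreviation const_endo ::
    "('v::ab_group_add \<Rightarrow> 'v) \<Rightarrow> (int \<Rightarrow>\<^sub>0 'v) \<Rightarrow> (int \<Rightarrow>\<^sub>0 'v)" where
  "const_endo f \<equiv> Poly_Mapping.map f"

definition paraunitary_group ::
    "('k::field \<Rightarrow> 'v::ab_group_add \<Rightarrow> 'v) \<Rightarrow> ('v \<Rightarrow> 'v \<Rightarrow> 'k) \<Rightarrow>
     ((int \<Rightarrow>\<^sub>0 'v) \<Rightarrow> (int \<Rightarrow>\<^sub>0 'v)) set" where
  "paraunitary_group scale b =
     {\<phi>. module_hom (laurent_scale scale) (laurent_scale scale) \<phi> \<and> bij \<phi> \<and>
          (\<forall>v w. laurent_form b (\<phi> v) (\<phi> w) = laurent_form b v w)}"

definition paraunitary_neg ::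
    "('k::field \<Rightarrow> 'v::ab_group_add \<Rightarrow> 'v) \<Rightarrow> ('v \<Rightarrow> 'v \<Rightarrow> 'k) \<Rightarrow>
     ((int \<Rightarrow>\<^sub>0 'v) \<Rightarrow> (int \<Rightarrow>\<^sub>0 'v)) set" where
  "paraunitary_neg scale b =
     {\<phi> \<in> paraunitary_group scale b. \<forall>i>0. endo_coeff \<phi> i = (\<lambda>v. 0)}"

definition pU ::
    "('k::field \<Rightarrow> 'v::ab_group_add \<Rightarrow> 'v) \<Rightarrow> ('v \<Rightarrow> 'v \<Rightarrow> 'k) \<Rightarrow> 'v set \<Rightarrow>
     (int \<Rightarrow>\<^sub>0 'v) \<Rightarrow> (int \<Rightarrow>\<^sub>0 'v)" where
  "pU scale b U v =
     laurent_scale scale (Poly_Mapping.single (- 1) 1) (const_endo (orth_proj b (orth b U)) v)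
     + const_endo (orth_proj b U) v"

text \<open>
  \<open>p = p\<^bsub>U\<^sub>1\<^esub> \<dots> p\<^bsub>U\<^sub>n\<^esub> h\<close> with \<open>n = length Us\<close>, where the
  list is indexed from \<open>0\<close>. The sum of subspaces is the elementwise sum of sets.
  Whole-space factors are allowed: \<open>p\<^sub>V = 1\<close>, and trailing factors \<open>U = V\<close> can always be appended, so
  uniqueness of the list needs either no such factors or a fixed length.
\<close>

definition normal_factorization ::
    "('k::field \<Rightarrow> 'v::ab_group_add \<Rightarrow> 'v) \<Rightarrow> ('v \<Rightarrow> 'v \<Rightarrow> 'k) \<Rightarrow>
     ((int \<Rightarrow>\<^sub>0 'v) \<Rightarrow> (int \<Rightarrow>\<^sub>0 'v)) \<Rightarrow> 'v set list \<Rightarrow> ('v \<Rightarrow> 'v) \<Rightarrow> bool" where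
  "normal_factorization scale b p Us h \<longleftrightarrow>
     (\<forall>U\<in>set Us. module.subspace scale U) \<and>
     h \<in> unitary_group scale b \<and>
     (\<forall>i. Suc i < length Us \<longrightarrow> orth b (Us ! i) + Us ! Suc i = UNIV) \<and>
     p = foldr (\<circ>) (map (pU scale b) Us) (const_endo h)"


lemma sum_keys_when:
  fixes g :: "int \<Rightarrow> 'v::zero \<Rightarrow> 'a::comm_monoid_add" and v :: "int \<Rightarrow>\<^sub>0 'v"
  assumes "g m 0 = 0"
  shows "(\<Sum>j\<in>Poly_Mapping.keys v. if j = m then g j (Poly_Mapping.lookup v j) else 0) =
         g m (Poly_Mapping.lookup v m)"
  using assms by (simp add: sum.delta in_keys_iff)

lemma lookup_laurent_scale:
  assumes "vector_space scale"
  shows "Poly_Mapping.lookup (laurent_scale scale f v) n =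
    (\<Sum>i\<in>Poly_Mapping.keys f. scale (Poly_Mapping.lookup f i) (Poly_Mapping.lookup v (n - i)))"
proof -
  interpret vector_space scale by fact
  have "(\<Sum>j\<in>Poly_Mapping.keys v.
      (scale (Poly_Mapping.lookup f i) (Poly_Mapping.lookup v j) when i + j = n)) =
      scale (Poly_Mapping.lookup f i) (Poly_Mapping.lookup v (n - i))" for i
  proof -
    have "(\<Sum>j\<in>Poly_Mapping.keys v.
        (scale (Poly_Mapping.lookup f i) (Poly_Mapping.lookup v j) when i + j = n)) =
        (\<Sum>j\<in>Poly_Mapping.keys v. if j = n - i
           then scale (Poly_Mapping.lookup f i) (Poly_Mapping.lookup v j) else 0)"
      by (rule sum.cong) (auto simp: when_def)
    then show ?thesis
      using sum_keys_when[of "\<lambda>_. scale (Poly_Mapping.lookup f i)" "n - i" v] by simp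
  qed
  then show ?thesis
    by (simp add: laurent_scale_def lookup_sum lookup_single)
qed

lemma lookup_laurent_form:
  assumes "symmetric_bilinear_form scale b"
  shows "Poly_Mapping.lookup (laurent_form b v w) n =
    (\<Sum>i\<in>Poly_Mapping.keys w. b (Poly_Mapping.lookup v (i - n)) (Poly_Mapping.lookup w i))"
proof -
  have b0: "b 0 y = 0" for y
    using assms unfolding symmetric_bilinear_form_def
    by (metis module_hom.zero Vector_Spaces.linear.axioms(3))
  have "(\<Sum>j\<in>Poly_Mapping.keys v.
      (b (Poly_Mapping.lookup v j) (Poly_Mapping.lookup w i) when i - j = n)) =
      b (Poly_Mapping.lookup v (i - n)) (Poly_Mapping.lookup w i)" for i
  proof -
    have "(\<Sum>j\<in>Poly_Mapping.keys v.
        (b (Poly_Mapping.lookup v j) (Poly_Mapping.lookup w i) when i - j = n)) =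
        (\<Sum>j\<in>Poly_Mapping.keys v. if j = i - n
           then b (Poly_Mapping.lookup v j) (Poly_Mapping.lookup w i) else 0)"
      by (rule sum.cong) (auto simp: when_def)
    then show ?thesis
      using sum_keys_when[of "\<lambda>_ x. b x (Poly_Mapping.lookup w i)" "i - n" v] b0 by simp
  qed
  moreover have "Poly_Mapping.lookup (laurent_form b v w) n =
    (\<Sum>i\<in>Poly_Mapping.keys w. \<Sum>j\<in>Poly_Mapping.keys v.
      (b (Poly_Mapping.lookup v j) (Poly_Mapping.lookup w i) when i - j = n))"
    unfolding laurent_form_def
    by (subst sum.swap) (simp add: lookup_sum lookup_single)
  ultimately show ?thesis by simp
qed

lemma module_laurent_scale:
  fixes scale :: "'k::field \<Rightarrow> 'v::ab_group_add \<Rightarrow> 'v"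
  assumes "vector_space scale"
  shows "module (laurent_scale scale)"
proof -
  interpret vector_space scale by fact
  note L = lookup_laurent_scale[OF assms]
  have Lsup: "Poly_Mapping.lookup (laurent_scale scale f v) n =
    (\<Sum>i\<in>S. scale (Poly_Mapping.lookup f i) (Poly_Mapping.lookup v (n - i)))"
    if "finite S" "Poly_Mapping.keys f \<subseteq> S" for S f v n
    unfolding L using that
    by (intro sum.mono_neutral_left) (auto simp: in_keys_iff)
  have add_left: "laurent_scale scale (f + g) v = laurent_scale scale f v + laurent_scale scale g v"
    for f g v
  proof (rule poly_mapping_eqI)
    fix n
    let ?S = "Poly_Mapping.keys f \<union> Poly_Mapping.keys g"
    show "Poly_Mapping.lookup (laurent_scale scale (f + g) v) n =
      Poly_Mapping.lookup (laurent_scale scale f v + laurent_scale scale g v) n"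
      using Poly_Mapping.keys_add[of f g]
      by (simp add: lookup_add Lsup[of ?S] scale_left_distrib sum.distrib)
  qed
  have add_right: "laurent_scale scale f (v + w) = laurent_scale scale f v + laurent_scale scale f w"
    for f v w
    by (rule poly_mapping_eqI) (simp add: lookup_add L scale_right_distrib sum.distrib)
  have lookup_s: "Poly_Mapping.lookup (laurent_scale scale (Poly_Mapping.single i a) v) n =
      scale a (Poly_Mapping.lookup v (n - i))" for i a v n
    by (simp add: Lsup[of "{i}"])
  have zero_left: "laurent_scale scale 0 v = 0" for v
    by (simp add: laurent_scale_def)
  have ind: "P f" if "P 0" "\<And>i a. P (Poly_Mapping.single i a)" "\<And>f g. P f \<Longrightarrow> P g \<Longrightarrow> P (f + g)"
    for P :: "(int \<Rightarrow>\<^sub>0 'k) \<Rightarrow> bool" and f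
  proof (induction f rule: Poly_Mapping.update_induct)
    case const then show ?case by (rule that(1))
  next
    case (update f a b)
    have "Poly_Mapping.update a b f = f + Poly_Mapping.single a b"
      using update by (intro poly_mapping_eqI)
        (auto simp: lookup_update lookup_add lookup_single in_keys_iff when_def)
    then show ?case using that(2,3) update.IH by simp
  qed
  have zero_right: "laurent_scale scale f 0 = 0" for f
    by (simp add: laurent_scale_def)
  have ss: "laurent_scale scale (Poly_Mapping.single i a) (laurent_scale scale g v) =
      laurent_scale scale (Poly_Mapping.single i a * g) v" for i a g v
  proof (induction g rule: ind)
    case 1 then show ?case by (simp add: zero_left zero_right)
  next
    case (2 j c)
    show ?case
      by (rule poly_mapping_eqI) (simp add: mult_single lookup_s algebra_simps)
  next
    case (3 g h) then show ?case by (simp add: distrib_left add_left add_right)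
  qed
  have assoc: "laurent_scale scale f (laurent_scale scale g v) = laurent_scale scale (f * g) v"
    for f g v
  proof (induction f rule: ind)
    case 1 then show ?case by (simp add: zero_left)
  next
    case (2 j c) show ?case by (rule ss)
  next
    case (3 f h) then show ?case by (simp add: distrib_right add_left)
  qed
  have one: "laurent_scale scale 1 v = v" for v
    using lookup_s[of 0 1 v] by (intro poly_mapping_eqI) simp
  show ?thesis
    by unfold_locales (simp_all add: add_left add_right assoc one)
qed

lemma lookup_laurent_endo:
  assumes "vector_space scale"
    and "module_hom (laurent_scale scale) (laurent_scale scale) \<phi>"
  shows "Poly_Mapping.lookup (\<phi> w) n =
    (\<Sum>j\<in>Poly_Mapping.keys w. endo_coeff \<phi> (n - j) (Poly_Mapping.lookup w j))"
proof -
  interpret vector_space scale by fact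
  interpret h: module_hom "laurent_scale scale" "laurent_scale scale" \<phi> by fact
  have shift: "Poly_Mapping.lookup (laurent_scale scale (Poly_Mapping.single j 1) v) n =
      Poly_Mapping.lookup v (n - j)" for j v n
    by (simp add: lookup_laurent_scale[OF assms(1)])
  have w: "w = (\<Sum>j\<in>Poly_Mapping.keys w. laurent_scale scale (Poly_Mapping.single j 1)
      (Poly_Mapping.single 0 (Poly_Mapping.lookup w j)))" (is "_ = ?R")
  proof (rule poly_mapping_eqI)
    fix n
    have "Poly_Mapping.lookup ?R n =
      (\<Sum>j\<in>Poly_Mapping.keys w. if j = n then Poly_Mapping.lookup w j else 0)"
      by (auto simp: lookup_sum shift lookup_single when_def intro!: sum.cong)
    then show "Poly_Mapping.lookup w n = Poly_Mapping.lookup ?R n"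
      using sum_keys_when[of "\<lambda>_ x. x" n w] by simp
  qed
  show ?thesis
    by (subst w) (simp add: h.sum h.scale lookup_sum shift endo_coeff_def)
qed

end

theory Submission
  imports Defs
begin

text \<open>
  Write \<open>p = \<Sum> t\<^sup>i p\<^sub>i\<close> with lowest exponent \<open>- d\<close>. In a normal factorization the first subspace
  is the image of \<open>p\<^sub>0\<close>, because \<open>U\<^sup>* + U' = V\<close> means that \<open>\<pi>\<^sub>U\<close> maps \<open>U'\<close> onto \<open>U\<close>; cancelling the
  first factor gives uniqueness for a given length, and factors \<open>p\<^sub>V = 1\<close> equalize the lengths.
  Conversely put \<open>U = im p\<^sub>0\<close> and \<open>q = p\<^sub>U\<^sup>-\<^sup>1 p\<close>. No positive powers of \<open>t\<close> occur in \<open>q\<close> since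
  \<open>1 - \<pi>\<^sub>U\<close> kills the image of \<open>p\<^sub>0\<close>, and if \<open>d > 0\<close>, the coefficient of \<open>t\<^sup>-\<^sup>d\<close> in the isometry relation is
  \<open>b(p\<^sub>0 v, p\<^sub>-\<^sub>d w) = 0\<close>, so \<open>p\<^sub>-\<^sub>d\<close> maps into \<open>U\<^sup>*\<close> and \<open>t\<^sup>-\<^sup>d\<close> no longer occurs in \<open>q\<close>.
\<close>

lemma lookup_const_endo:
  assumes "f 0 = 0"
  shows "Poly_Mapping.lookup (const_endo f v) n = f (Poly_Mapping.lookup v n)"
  using assms by (simp add: Poly_Mapping.map.rep_eq when_def)

locale anisotropic_space = finite_dimensional_vector_space scale Basis
  for scale :: "'k::field \<Rightarrow> 'v::ab_group_add \<Rightarrow> 'v" and Basis :: "'v set" +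
  fixes b :: "'v \<Rightarrow> 'v \<Rightarrow> 'k"
  assumes form: "symmetric_bilinear_form scale b"
    and aniso: "anisotropic b"
begin

section \<open>Orthogonal complements and projections\<close>

lemma form_linear_right: "Vector_Spaces.linear scale (*) (b v)"
  using form unfolding symmetric_bilinear_form_def by auto

lemma form_sym: "b v w = b w v"
  using form unfolding symmetric_bilinear_form_def by auto

lemma form_add_right: "b v (x + y) = b v x + b v y"
  and form_diff_right: "b v (x - y) = b v x - b v y"
  and form_scale_right: "b v (scale c x) = c * b v x"
  and form_zero_right [simp]: "b v 0 = 0"
proof -
  interpret l: Vector_Spaces.linear scale "(*)" "b v" by (rule form_linear_right)
  show "b v (x + y) = b v x + b v y" "b v (x - y) = b v x - b v y"
    "b v (scale c x) = c * b v x" "b v 0 = 0"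
    by (simp_all add: l.add l.diff l.scale l.zero)
qed

lemma form_add_left: "b (x + y) v = b x v + b y v"
  and form_diff_left: "b (x - y) v = b x v - b y v"
  and form_scale_left: "b (scale c x) v = c * b x v"
  and form_zero_left [simp]: "b 0 v = 0"
  using form_add_right form_diff_right form_scale_right form_zero_right by (metis form_sym)+

lemma form_self_eq_0_iff: "b v v = 0 \<longleftrightarrow> v = 0"
  using aniso unfolding anisotropic_def by auto

lemma subspace_orth: "subspace (orth b U)"
  unfolding subspace_def orth_def by (auto simp: form_add_right form_scale_right)

lemma orth_spanD:
  assumes "v \<in> orth b B" "u \<in> span B"
  shows "b u v = 0"
  using assms(2)
proof (induction rule: span_induct_alt)
  case (step c x y)
  then show ?case using assms(1) by (simp add: form_add_left form_scale_left orth_def)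
qed simp

text \<open>Gram-Schmidt: the new spanning vector is replaced by its component orthogonal to the
  span of the earlier ones, and the earlier approximation of \<open>v\<close> is corrected along
  it.\<close>

lemma orth_decomposition_span:
  assumes "finite B"
  shows "\<exists>u\<in>span B. v - u \<in> orth b B"
  using assms
proof (induction B arbitrary: v rule: finite_induct)
  case empty
  then show ?case by (simp add: orth_def)
next
  case (insert x B)
  obtain y where y: "y \<in> span B" "x - y \<in> orth b B" using insert.IH by blast
  obtain u where u: "u \<in> span B" "v - u \<in> orth b B" using insert.IH by blast
  define x' where "x' = x - y"
  \<comment> \<open>The coefficient uses \<open>b v x'\<close> because \<open>u\<close> is already
    orthogonal to \<open>x'\<close>. Anisotropy keeps the denominator nonzero unless
    \<open>x' = 0\<close>, and then the whole correction vanishes.\<close>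
  define u' where "u' = u + scale (b v x' / b x' x') x'"
  have sub: "span B \<subseteq> span (insert x B)" by (intro span_mono) auto
  have ux': "b u x' = 0" and vy: "b (v - u) y = 0"
    using orth_spanD[OF y(2) u(1)] orth_spanD[OF u(2) y(1)] form_sym[of y "v - u"]
    by (simp_all add: x'_def)
  have yx': "b y x' = 0"
    using orth_spanD[OF y(2) y(1)] by (simp add: x'_def)
  have vx': "b (v - u') x' = 0"
    by (cases "x' = 0")
      (auto simp: u'_def form_diff_left form_add_left form_scale_left form_self_eq_0_iff ux')
  \<comment> \<open>Since \<open>x = x' + y\<close>, it suffices to test against \<open>x'\<close>
    and against \<open>y\<close> in \<open>span B\<close>.\<close>
  have "b x (v - u') = 0"
  proof -
    have "b x (v - u') = b x' (v - u') + b y (v - u')"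
      by (simp add: x'_def form_diff_left)
    moreover have "b y (v - u') = 0"
      using vy yx' form_sym[of y "v - u"]
      by (simp add: u'_def form_diff_right form_add_right form_scale_right)
    ultimately show ?thesis using vx' form_sym[of x' "v - u'"] by simp
  qed
  moreover have "b z (v - u') = 0" if "z \<in> B" for z
    using u(2) y(2) that
    by (simp add: u'_def x'_def orth_def form_diff_right form_add_right form_scale_right)
  moreover have "u' \<in> span (insert x B)"
    unfolding u'_def x'_def
    by (intro span_add span_scale span_diff subsetD[OF sub u(1)] subsetD[OF sub y(1)]
        span_base insertI1)
  ultimately show ?case by (auto simp: orth_def)
qed

lemma orth_decomposition:
  assumes "subspace U"
  shows "\<exists>u\<in>U. v - u \<in> orth b U"
proof -
  obtain B where B: "B \<subseteq> U" "independent B" "U \<subseteq> span B" by (rule basis_exists)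
  have "finite B" using B(2) by (rule finiteI_independent)
  moreover have "span B = U" using B(3) span_minimal[OF B(1) assms] by (rule antisym[rotated])
  moreover have "orth b B \<subseteq> orth b (span B)" using orth_spanD by (auto simp: orth_def[of b "span B"])
  ultimately show ?thesis using orth_decomposition_span[of B v] by auto
qed

text \<open>The difference of two candidates is orthogonal to itself, so anisotropy makes it
  zero.\<close>

lemma orth_decomposition_unique:
  assumes "subspace U" "u \<in> U" "v - u \<in> orth b U" "u' \<in> U" "v - u' \<in> orth b U"
  shows "u = u'"
proof -
  have "u - u' \<in> U" using assms by (simp add: subspace_diff)
  moreover have "(v - u') - (v - u) \<in> orth b U"
    using assms subspace_orth subspace_diff by blast
  ultimately have "b (u - u') (u - u') = 0" by (auto simp: orth_def)
  then show ?thesis by (simp add: form_self_eq_0_iff)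
qed

lemma orth_proj_eq:
  assumes "subspace U" "u \<in> U" "v - u \<in> orth b U"
  shows "orth_proj b U v = u"
  unfolding orth_proj_def using orth_decomposition_unique[OF assms(1)] assms by blast

lemma
  assumes "subspace U"
  shows orth_proj_in: "orth_proj b U v \<in> U"
    and diff_orth_proj_in: "v - orth_proj b U v \<in> orth b U"
  using orth_decomposition[OF assms, of v] orth_proj_eq[OF assms] by auto

text \<open>What remains after subtracting \<open>v - orth_proj b U v\<close> is the
  \<open>U\<close>-component, which is orthogonal to \<open>orth b U\<close>. Coefficients of the
  factors can thus be written with \<open>orth_proj b U\<close> alone.\<close>

lemma orth_proj_orth:
  assumes "subspace U"
  shows "orth_proj b (orth b U) v = v - orth_proj b U v"
proof (rule orth_proj_eq)
  show "v - (v - orth_proj b U v) \<in> orth b (orth b U)"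
    using orth_proj_in[OF assms] by (auto simp: orth_def form_sym)
qed (use assms in \<open>auto simp: subspace_orth diff_orth_proj_in\<close>)

lemma linear_orth_proj:
  assumes "subspace U"
  shows "Vector_Spaces.linear scale scale (orth_proj b U)"
proof -
  note P = orth_proj_in[OF assms] diff_orth_proj_in[OF assms]
  have "orth_proj b U (x + y) = orth_proj b U x + orth_proj b U y" for x y
  proof (rule orth_proj_eq[OF assms])
    have "(x - orth_proj b U x) + (y - orth_proj b U y) \<in> orth b U"
      using P subspace_orth subspace_add by blast
    then show "x + y - (orth_proj b U x + orth_proj b U y) \<in> orth b U"
      by (simp add: algebra_simps)
  qed (simp add: assms P subspace_add)
  moreover have "orth_proj b U (scale c x) = scale c (orth_proj b U x)" for c x
  proof (rule orth_proj_eq[OF assms])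
    have "scale c (x - orth_proj b U x) \<in> orth b U"
      using P subspace_orth subspace_scale by blast
    then show "scale c x - scale c (orth_proj b U x) \<in> orth b U"
      by (simp add: scale_right_diff_distrib)
  qed (simp add: assms P subspace_scale)
  ultimately show ?thesis by unfold_locales auto
qed

lemma orth_proj_id:
  assumes "subspace U" "u \<in> U"
  shows "orth_proj b U u = u"
  by (rule orth_proj_eq) (use assms in \<open>auto simp: orth_def\<close>)

lemma orth_proj_of_orth:
  assumes "subspace U" "u \<in> orth b U"
  shows "orth_proj b U u = 0"
  by (rule orth_proj_eq) (use assms in \<open>auto simp: subspace_0\<close>)

text \<open>Cross terms between \<open>U\<close> and its complement vanish. The two components come
  from unrelated vectors because a coefficient of \<open>twist\<close> combines projections of two
  different coefficients.\<close>

lemma form_orth_split: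
  assumes "subspace U"
  shows "b (x - orth_proj b U x + orth_proj b U x') (y - orth_proj b U y + orth_proj b U y') =
    b (x - orth_proj b U x) (y - orth_proj b U y) + b (orth_proj b U x') (orth_proj b U y')"
proof -
  have "b (orth_proj b U x') (y - orth_proj b U y) = 0"
    "b (orth_proj b U y') (x - orth_proj b U x) = 0"
    using orth_proj_in[OF assms] diff_orth_proj_in[OF assms] by (auto simp: orth_def)
  then show ?thesis
    using form_sym[of "orth_proj b U y'" "x - orth_proj b U x"]
    by (simp add: form_add_left form_add_right)
qed

section \<open>The factors as paraunitary maps, with their inverses\<close>

abbreviation "smult_L \<equiv> laurent_scale scale"

text \<open>Multiplication by \<open>t^e\<close> on the complement of \<open>U\<close> and the
  identity on \<open>U\<close>: \<open>e = -1\<close> gives \<open>pU\<close>, and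
  \<open>e = 1\<close> its inverse.\<close>

definition twist :: "int \<Rightarrow> 'v set \<Rightarrow> (int \<Rightarrow>\<^sub>0 'v) \<Rightarrow> (int \<Rightarrow>\<^sub>0 'v)" where
  "twist e U v = smult_L (Poly_Mapping.single e 1) (const_endo (orth_proj b (orth b U)) v)
     + const_endo (orth_proj b U) v"

lemma pU_eq_twist: "pU scale b U = twist (- 1) U"
  by (rule ext) (simp add: pU_def twist_def)

lemma lookup_twist:
  assumes "subspace U"
  shows "Poly_Mapping.lookup (twist e U v) n =
    Poly_Mapping.lookup v (n - e) - orth_proj b U (Poly_Mapping.lookup v (n - e))
    + orth_proj b U (Poly_Mapping.lookup v n)"
  by (simp add: twist_def lookup_add lookup_laurent_scale[OF vector_space_axioms]
      lookup_const_endo orth_proj_id subspace_0 assms subspace_orth orth_proj_orth)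

text \<open>The sign of \<open>e\<close> is left open: \<open>e = 1\<close> cancels a factor in the
  uniqueness proof, \<open>e = - 1\<close> restores one in the existence proof.\<close>

lemma twist_inverse:
  assumes "subspace U"
  shows "twist e U \<circ> twist (- e) U = id"
proof -
  interpret P: Vector_Spaces.linear scale scale "orth_proj b U" by (rule linear_orth_proj[OF assms])
  have "twist e U (twist (- e) U v) = v" for v
    by (rule poly_mapping_eqI)
      (simp add: lookup_twist[OF assms] P.add P.diff orth_proj_id[OF assms] orth_proj_in[OF assms])
  then show ?thesis by auto
qed

lemma twist_UNIV: "twist e UNIV = id"
  by (auto simp: lookup_twist orth_proj_id intro!: ext poly_mapping_eqI)

lemma module_hom_twist:
  assumes "subspace U"
  shows "module_hom smult_L smult_L (twist e U)"
proof -
  interpret L: module smult_L by (rule module_laurent_scale[OF vector_space_axioms])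
  interpret P: Vector_Spaces.linear scale scale "orth_proj b U" by (rule linear_orth_proj[OF assms])
  have "twist e U (v + w) = twist e U v + twist e U w" for v w
    by (rule poly_mapping_eqI) (simp add: lookup_twist[OF assms] lookup_add P.add)
  moreover have "twist e U (smult_L f v) = smult_L f (twist e U v)" for f v
    by (rule poly_mapping_eqI)
      (simp add: lookup_twist[OF assms] lookup_laurent_scale[OF vector_space_axioms] P.sum P.scale
        scale_right_diff_distrib scale_right_distrib sum.distrib sum_subtractf algebra_simps)
  ultimately show ?thesis by unfold_locales auto
qed

lemma lookup_laurent_form_superset:
  assumes "finite S" "Poly_Mapping.keys w \<subseteq> S"
  shows "Poly_Mapping.lookup (laurent_form b v w) n =
    (\<Sum>i\<in>S. b (Poly_Mapping.lookup v (i - n)) (Poly_Mapping.lookup w i))"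
  unfolding lookup_laurent_form[OF form]
  by (rule sum.mono_neutral_left) (use assms in \<open>auto simp: in_keys_iff\<close>)

text \<open>The form sees only differences of exponents, and on the complement of \<open>U\<close>
  both arguments are shifted by the same \<open>e\<close>.\<close>

lemma laurent_form_twist:
  assumes "subspace U"
  shows "laurent_form b (twist e U v) (twist e U w) = laurent_form b v w"
proof (rule poly_mapping_eqI)
  fix n
  let ?l = Poly_Mapping.lookup and ?K = "Poly_Mapping.keys w" and ?P = "orth_proj b U"
  \<comment> \<open>One index set covering the support of \<open>w\<close> and its shift, so that
    both components can be summed over it before each is cut back to its own support.\<close>
  let ?S = "?K \<union> (\<lambda>i. i + e) ` ?K"
  have P0: "?P 0 = 0" using assms by (simp add: orth_proj_id subspace_0)
  have K: "?l w i = 0" if "i \<notin> ?K" for i using that by (simp add: in_keys_iff)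
  have K': "?l w (i - e) = 0" if "i \<notin> (\<lambda>i. i + e) ` ?K" for i
    by (rule K) (use that in \<open>auto simp: image_iff algebra_simps dest: bspec[where x = "i - e"]\<close>)
  have "Poly_Mapping.keys (twist e U w) \<subseteq> ?S"
  proof
    fix i assume "i \<in> Poly_Mapping.keys (twist e U w)"
    then show "i \<in> ?S"
      by (rule contrapos_pp) (simp add: in_keys_iff lookup_twist[OF assms] K K' P0)
  qed
  then have "?l (laurent_form b (twist e U v) (twist e U w)) n =
    (\<Sum>i\<in>?S. b (?l (twist e U v) (i - n)) (?l (twist e U w) i))"
    by (intro lookup_laurent_form_superset) auto
  also have "\<dots> = (\<Sum>i\<in>?S. b (?l v (i - n - e) - ?P (?l v (i - n - e))) (?l w (i - e) - ?P (?l w (i - e))))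
      + (\<Sum>i\<in>?S. b (?P (?l v (i - n))) (?P (?l w i)))"
    by (simp only: lookup_twist[OF assms] form_orth_split[OF assms] sum.distrib)
  also have "(\<Sum>i\<in>?S. b (?l v (i - n - e) - ?P (?l v (i - n - e))) (?l w (i - e) - ?P (?l w (i - e))))
      = (\<Sum>i\<in>(\<lambda>i. i + e) ` ?K. b (?l v (i - n - e) - ?P (?l v (i - n - e))) (?l w (i - e) - ?P (?l w (i - e))))"
    by (rule sum.mono_neutral_right) (auto simp: K' P0)
  \<comment> \<open>Reindexing by \<open>i + e\<close> undoes the shift in both arguments at
    once.\<close>
  also have "\<dots> = (\<Sum>i\<in>?K. b (?l v (i - n) - ?P (?l v (i - n))) (?l w i - ?P (?l w i)))"
    by (subst sum.reindex) (auto simp: inj_on_def algebra_simps)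
  also have "(\<Sum>i\<in>?S. b (?P (?l v (i - n))) (?P (?l w i)))
      = (\<Sum>i\<in>?K. b (?P (?l v (i - n))) (?P (?l w i)))"
    by (rule sum.mono_neutral_right) (auto simp: K P0)
  also have "(\<Sum>i\<in>?K. b (?l v (i - n) - ?P (?l v (i - n))) (?l w i - ?P (?l w i))) + \<dots>
      = (\<Sum>i\<in>?K. b (?l v (i - n)) (?l w i))"
    unfolding sum.distrib[symmetric] form_orth_split[OF assms, symmetric] by simp
  also have "\<dots> = ?l (laurent_form b v w) n"
    by (simp add: lookup_laurent_form[OF form])
  finally show "?l (laurent_form b (twist e U v) (twist e U w)) n = ?l (laurent_form b v w) n" .
qed

section \<open>Coefficients of Laurent isometries\<close>

definition laurent_isometry :: "((int \<Rightarrow>\<^sub>0 'v) \<Rightarrow> (int \<Rightarrow>\<^sub>0 'v)) \<Rightarrow> bool" where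
  "laurent_isometry \<phi> \<longleftrightarrow> module_hom smult_L smult_L \<phi> \<and>
     (\<forall>v w. laurent_form b (\<phi> v) (\<phi> w) = laurent_form b v w)"

text \<open>Provides the invariant of the existence induction: stripping off a factor leaves a
  Laurent isometry.\<close>

lemma laurent_isometry_twist_comp:
  assumes "subspace U" "laurent_isometry \<phi>"
  shows "laurent_isometry (twist e U \<circ> \<phi>)"
  using assms module_hom_compose[OF _ module_hom_twist[OF assms(1)]]
  by (auto simp: laurent_isometry_def laurent_form_twist)

lemma endo_coeff_twist_comp:
  assumes "subspace U"
  shows "endo_coeff (twist e U \<circ> \<phi>) n v =
    endo_coeff \<phi> (n - e) v - orth_proj b U (endo_coeff \<phi> (n - e) v)
    + orth_proj b U (endo_coeff \<phi> n v)"
  by (simp add: endo_coeff_def lookup_twist[OF assms])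

lemma linear_endo_coeff:
  assumes "module_hom smult_L smult_L \<phi>"
  shows "Vector_Spaces.linear scale scale (endo_coeff \<phi> i)"
proof -
  interpret h: module_hom smult_L smult_L \<phi> by fact
  have "endo_coeff \<phi> i (x + y) = endo_coeff \<phi> i x + endo_coeff \<phi> i y" for x y
    by (simp add: endo_coeff_def single_add h.add lookup_add)
  moreover have "endo_coeff \<phi> i (scale c x) = scale c (endo_coeff \<phi> i x)" for c x
  proof -
    have "Poly_Mapping.single 0 (scale c x) =
        smult_L (Poly_Mapping.single 0 c) (Poly_Mapping.single 0 x)"
      by (rule poly_mapping_eqI)
        (auto simp: lookup_laurent_scale[OF vector_space_axioms] lookup_single when_def)
    then show ?thesis
      by (auto simp: endo_coeff_def h.scale lookup_laurent_scale[OF vector_space_axioms])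
  qed
  ultimately show ?thesis by unfold_locales auto
qed

text \<open>The images of the finitely many basis vectors have finite support, hence a common lower
  bound on exponents; linearity extends it to all of \<open>V\<close>.\<close>

lemma endo_coeff_lower_bound:
  assumes "module_hom smult_L smult_L \<phi>"
  shows "\<exists>d::nat. \<forall>i < - int d. endo_coeff \<phi> i = (\<lambda>v. 0)"
proof -
  let ?K = "\<Union>x\<in>Basis. Poly_Mapping.keys (\<phi> (Poly_Mapping.single 0 x))"
  have "finite ?K" using finite_Basis by auto
  then obtain m where m: "\<And>i. i \<in> ?K \<Longrightarrow> m \<le> i"
    by (metis Min_le)
  \<comment> \<open>For \<open>m > 0\<close> the truncation \<open>nat (- m)\<close> is 0, and
    \<open>i < 0\<close> still lies below \<open>m\<close>.\<close>
  have "endo_coeff \<phi> i v = 0" if "i < - int (nat (- m))" for i v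
  proof -
    interpret l: Vector_Spaces.linear scale scale "endo_coeff \<phi> i"
      by (rule linear_endo_coeff[OF assms])
    have i: "i \<notin> ?K" using that m[of i] by linarith
    have "v \<in> span Basis" by (simp add: span_Basis)
    then show ?thesis
    proof (induction rule: span_induct_alt)
      case base
      show ?case by (rule l.zero)
    next
      case (step c x y)
      then have "endo_coeff \<phi> i x = 0" using i by (auto simp: endo_coeff_def in_keys_iff)
      then show ?case using step by (simp add: l.add l.scale)
    qed
  qed
  then show ?thesis by blast
qed

text \<open>The coefficient of \<open>t^n\<close> in the isometry relation, evaluated on the
  constant vectors \<open>v\<close> and \<open>w\<close>.\<close>

lemma sum_form_endo_coeff:
  assumes "laurent_isometry \<phi>" "\<And>i. i > 0 \<Longrightarrow> endo_coeff \<phi> i = (\<lambda>v. 0)"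
    and "\<And>i. i < - int d \<Longrightarrow> endo_coeff \<phi> i = (\<lambda>v. 0)"
  shows "(\<Sum>i\<in>{- int d..0}. b (endo_coeff \<phi> (i - n) v) (endo_coeff \<phi> i w)) =
    (if n = 0 then b v w else 0)"
proof -
  let ?s = "Poly_Mapping.single (0::int)"
  have "Poly_Mapping.keys (\<phi> (?s w)) \<subseteq> {- int d..0}"
  proof
    fix i assume "i \<in> Poly_Mapping.keys (\<phi> (?s w))"
    then have "endo_coeff \<phi> i w \<noteq> 0" by (simp add: endo_coeff_def in_keys_iff)
    then show "i \<in> {- int d..0}" using assms(2)[of i] assms(3)[of i] by force
  qed
  then have "(\<Sum>i\<in>{- int d..0}. b (endo_coeff \<phi> (i - n) v) (endo_coeff \<phi> i w)) =
      Poly_Mapping.lookup (laurent_form b (\<phi> (?s v)) (\<phi> (?s w))) n"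
    by (simp add: lookup_laurent_form_superset[of "{- int d..0}"] endo_coeff_def)
  also have "\<dots> = Poly_Mapping.lookup (laurent_form b (?s v) (?s w)) n"
    using assms(1) by (simp add: laurent_isometry_def)
  also have "\<dots> = (if n = 0 then b v w else 0)"
    by (subst lookup_laurent_form_superset[of "{0}"]) (auto simp: lookup_single when_def)
  finally show ?thesis .
qed

lemma extreme_coeffs_orthogonal:
  assumes "laurent_isometry \<phi>" "\<And>i. i > 0 \<Longrightarrow> endo_coeff \<phi> i = (\<lambda>v. 0)"
    and "\<And>i. i < - int d \<Longrightarrow> endo_coeff \<phi> i = (\<lambda>v. 0)" and "d > 0"
  shows "b (endo_coeff \<phi> 0 v) (endo_coeff \<phi> (- int d) w) = 0"
proof -
  have "0 = (\<Sum>i\<in>{- int d..0}. b (endo_coeff \<phi> (i - (- int d)) v) (endo_coeff \<phi> i w))"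
    using sum_form_endo_coeff[OF assms(1-3), of d "- int d" v w] assms(4) by simp
  \<comment> \<open>For \<open>i > - int d\<close> the first coefficient has the positive index
    \<open>i + d\<close> and vanishes.\<close>
  also have "\<dots> = (\<Sum>i\<in>{- int d}. b (endo_coeff \<phi> (i - (- int d)) v) (endo_coeff \<phi> i w))"
    by (rule sum.mono_neutral_right) (auto simp: assms(2))
  finally show ?thesis by simp
qed

text \<open>Base case of the factorization: with only index 0 left, the isometry relation at
  \<open>n = 0\<close> is unitarity of that coefficient, and the coefficients determine the
  map.\<close>

lemma constant_isometry:
  assumes "laurent_isometry \<phi>" "\<And>i. i \<noteq> 0 \<Longrightarrow> endo_coeff \<phi> i = (\<lambda>v. 0)"
  shows "endo_coeff \<phi> 0 \<in> unitary_group scale b" "\<phi> = const_endo (endo_coeff \<phi> 0)"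
proof -
  have hom: "module_hom smult_L smult_L \<phi>" using assms(1) by (simp add: laurent_isometry_def)
  interpret l: Vector_Spaces.linear scale scale "endo_coeff \<phi> 0" by (rule linear_endo_coeff[OF hom])
  show "endo_coeff \<phi> 0 \<in> unitary_group scale b"
    using sum_form_endo_coeff[OF assms(1), of 0 0] assms(2) l.linear_axioms
    by (auto simp: unitary_group_def)
  show "\<phi> = const_endo (endo_coeff \<phi> 0)"
  proof (intro ext poly_mapping_eqI)
    fix w n
    have "Poly_Mapping.lookup (\<phi> w) n =
        (\<Sum>j\<in>Poly_Mapping.keys w. if j = n then endo_coeff \<phi> 0 (Poly_Mapping.lookup w j) else 0)"
      unfolding lookup_laurent_endo[OF vector_space_axioms hom]
      by (rule sum.cong) (auto simp: assms(2))
    also have "\<dots> = endo_coeff \<phi> 0 (Poly_Mapping.lookup w n)"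
      using sum_keys_when[of "\<lambda>_. endo_coeff \<phi> 0" n w] l.zero by simp
    finally show "Poly_Mapping.lookup (\<phi> w) n =
        Poly_Mapping.lookup (const_endo (endo_coeff \<phi> 0) w) n"
      by (simp add: lookup_const_endo l.zero)
  qed
qed

section \<open>Unitary maps and recursion along the list of subspaces\<close>

lemma unitary_form: "h \<in> unitary_group scale b \<Longrightarrow> b (h v) (h w) = b v w"
  by (simp add: unitary_group_def)

lemma unitary_eq_0_iff:
  assumes "h \<in> unitary_group scale b"
  shows "h v = 0 \<longleftrightarrow> v = 0"
  using unitary_form[OF assms, of v v] form_self_eq_0_iff[of v] form_self_eq_0_iff[of "h v"] by simp

text \<open>Anisotropy gives injectivity and finite dimension then surjectivity. This makes the
  image of the constant coefficient all of \<open>V\<close> when the list is empty.\<close>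

lemma unitary_surj:
  assumes "h \<in> unitary_group scale b"
  shows "surj h"
proof -
  have lin: "Vector_Spaces.linear scale scale h" using assms by (simp add: unitary_group_def)
  interpret l: Vector_Spaces.linear scale scale h by (rule lin)
  have "inj h" by (simp add: l.inj_iff_eq_0 unitary_eq_0_iff[OF assms])
  then show ?thesis by (rule linear_inj_imp_surj[OF lin])
qed

lemma endo_coeff_const_endo:
  "f 0 = 0 \<Longrightarrow> endo_coeff (const_endo f) i v = (if i = 0 then f v else 0)"
  by (simp add: endo_coeff_def lookup_const_endo lookup_single when_def)

lemma normal_factorization_Nil:
  "normal_factorization scale b p [] h \<longleftrightarrow> h \<in> unitary_group scale b \<and> p = const_endo h"
  by (simp add: normal_factorization_def)

lemma normal_factorization_Cons:
  "normal_factorization scale b p (U # Us) h \<longleftrightarrow>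
    subspace U \<and> (Us \<noteq> [] \<longrightarrow> orth b U + hd Us = UNIV) \<and>
    (\<exists>q. p = twist (- 1) U \<circ> q \<and> normal_factorization scale b q Us h)"
proof -
  have "(\<forall>i. Suc i < length (U # Us) \<longrightarrow> orth b ((U # Us) ! i) + (U # Us) ! Suc i = UNIV) \<longleftrightarrow>
      (Us \<noteq> [] \<longrightarrow> orth b U + hd Us = UNIV) \<and>
      (\<forall>i. Suc i < length Us \<longrightarrow> orth b (Us ! i) + Us ! Suc i = UNIV)"
    by (cases Us) (simp_all add: All_less_Suc2)
  then show ?thesis
    by (auto simp: normal_factorization_def pU_eq_twist)
qed

text \<open>The kernel of \<open>orth_proj b U\<close> is \<open>orth b U\<close>, so both sides say
  that \<open>W\<close> meets every coset of \<open>orth b U\<close>. Left to right serves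
  uniqueness, right to left existence.\<close>

lemma orth_proj_image_iff:
  assumes "subspace U" "subspace W"
  shows "orth b U + W = UNIV \<longleftrightarrow> orth_proj b U ` W = U"
proof
  interpret P: Vector_Spaces.linear scale scale "orth_proj b U" by (rule linear_orth_proj[OF assms(1)])
  {
    assume sum: "orth b U + W = UNIV"
    have "u \<in> orth_proj b U ` W" if "u \<in> U" for u
    proof -
      have "u \<in> orth b U + W" using sum by simp
      then obtain x w where xw: "x \<in> orth b U" "w \<in> W" "u = x + w" by (auto elim: set_plus_elim)
      have "u = orth_proj b U w"
        using orth_proj_id[OF assms(1) that] orth_proj_of_orth[OF assms(1) xw(1)] xw(3)
        by (simp add: P.add)
      then show ?thesis using xw(2) by blast
    qed
    then show "orth_proj b U ` W = U" using orth_proj_in[OF assms(1)] by auto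
  next
    assume im: "orth_proj b U ` W = U"
    have "v \<in> orth b U + W" for v
    proof -
      obtain w where w: "w \<in> W" "orth_proj b U v = orth_proj b U w"
        using im orth_proj_in[OF assms(1), of v] by (metis imageE)
      have "(v - w) - orth_proj b U (v - w) \<in> orth b U" by (rule diff_orth_proj_in[OF assms(1)])
      then have "v - w \<in> orth b U" using w(2) by (simp add: P.diff)
      then have "(v - w) + w \<in> orth b U + W" using w(1) by (rule set_plus_intro)
      then show ?thesis by simp
    qed
    then show "orth b U + W = UNIV" by auto
  }
qed

lemma normal_factorization_coeffs:
  assumes "normal_factorization scale b p Us h"
  shows "\<And>i. i > 0 \<Longrightarrow> endo_coeff p i = (\<lambda>v. 0)"
    and "range (endo_coeff p 0) = (if Us = [] then UNIV else hd Us)"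
proof -
  have "(\<forall>i>0. endo_coeff p i = (\<lambda>v. 0)) \<and>
      range (endo_coeff p 0) = (if Us = [] then UNIV else hd Us)"
    using assms
  proof (induction Us arbitrary: p)
    case Nil
    then show ?case
      by (auto simp: normal_factorization_Nil endo_coeff_const_endo unitary_eq_0_iff
          dest!: unitary_surj intro!: ext)
  next
    case (Cons U Us)
    then obtain q where q: "p = twist (- 1) U \<circ> q" "normal_factorization scale b q Us h"
      and U: "subspace U" and sum: "Us \<noteq> [] \<longrightarrow> orth b U + hd Us = UNIV"
      by (auto simp: normal_factorization_Cons)
    \<comment> \<open>Reading an empty tail as starting with \<open>V\<close> lets the last factor
      be treated like the others.\<close>
    let ?W = "if Us = [] then UNIV else hd Us"
    have W: "subspace ?W" using q(2) by (auto simp: normal_factorization_def)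
    have P0: "orth_proj b U 0 = 0" using U by (simp add: orth_proj_id subspace_0)
    from Cons.IH[OF q(2)] have IH: "\<And>i. i > 0 \<Longrightarrow> endo_coeff q i = (\<lambda>v. 0)"
      "range (endo_coeff q 0) = ?W" by auto
    have "endo_coeff p i = (\<lambda>v. 0)" if "i > 0" for i
      using that IH(1)[of i] IH(1)[of "i + 1"] P0
      by (intro ext) (simp add: q(1) endo_coeff_twist_comp[OF U])
    \<comment> \<open>The other contribution comes from the coefficient of \<open>q\<close> at index
      1, which vanishes.\<close>
    moreover have "endo_coeff p 0 v = orth_proj b U (endo_coeff q 0 v)" for v
      using IH(1)[of 1] P0 by (simp add: q(1) endo_coeff_twist_comp[OF U])
    then have "range (endo_coeff p 0) = orth_proj b U ` ?W"
      unfolding IH(2)[symmetric] by (auto simp: image_def)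
    moreover have "orth_proj b U ` ?W = U"
    proof (cases "Us = []")
      case True
      then show ?thesis
        using orth_proj_in[OF U] orth_proj_id[OF U] by (auto simp: image_iff) (metis)
    next
      case False
      then show ?thesis using sum W orth_proj_image_iff[OF U W] by simp
    qed
    ultimately show ?case by auto
  qed
  then show "\<And>i. i > 0 \<Longrightarrow> endo_coeff p i = (\<lambda>v. 0)"
    and "range (endo_coeff p 0) = (if Us = [] then UNIV else hd Us)" by auto
qed

section \<open>Uniqueness for equal lengths, and padding by trivial factors\<close>

lemma normal_factorization_unique:
  assumes "length Us = length Us'"
    and "normal_factorization scale b p Us h" "normal_factorization scale b p Us' h'"
  shows "Us = Us' \<and> h = h'"
  using assms
proof (induction Us Us' arbitrary: p rule: list_induct2)
  case Nil
  then have "h v = h' v" for v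
    using endo_coeff_const_endo[of h 0 v] endo_coeff_const_endo[of h' 0 v]
    by (simp add: normal_factorization_Nil unitary_eq_0_iff)
  then show ?case by auto
next
  case (Cons U Us U' Us')
  \<comment> \<open>Both lists are nonempty, so both first subspaces equal the image of the constant
    coefficient of \<open>p\<close>.\<close>
  have eq: "U = U'"
    using normal_factorization_coeffs(2)[OF Cons.prems(1)]
      normal_factorization_coeffs(2)[OF Cons.prems(2)] by simp
  obtain q q' where q: "p = twist (- 1) U \<circ> q" "normal_factorization scale b q Us h"
    and q': "p = twist (- 1) U \<circ> q'" "normal_factorization scale b q' Us' h'"
    and U: "subspace U"
    using Cons.prems eq by (auto simp: normal_factorization_Cons)
  have "twist 1 U \<circ> (twist (- 1) U \<circ> r) = r" for r
    using twist_inverse[OF U, of 1] by (simp flip: comp_assoc)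
  then have "q = q'" using q(1) q'(1) by metis
  then show ?case using Cons.IH[OF q(2)] q'(2) eq by simp
qed

lemma normal_factorization_append_UNIV:
  assumes "normal_factorization scale b p Us h"
  shows "normal_factorization scale b p (Us @ replicate m UNIV) h"
proof -
  have snoc: "normal_factorization scale b p (Us @ [UNIV]) h"
    if "normal_factorization scale b p Us h" for p Us
    using that
  proof (induction Us arbitrary: p)
    case Nil
    then show ?case by (auto simp: normal_factorization_Cons twist_UNIV)
  next
    case (Cons U Us)
    \<comment> \<open>Appending \<open>UNIV\<close> creates one new junction, which holds because
      the complement contains 0.\<close>
    have "0 \<in> orth b U" by (simp add: orth_def)
    then have "orth b U + UNIV = UNIV" using set_zero_plus2 by blast
    then show ?case using Cons by (cases Us) (auto simp: normal_factorization_Cons[of _ U])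
  qed
  show ?thesis
  proof (induction m)
    case (Suc m)
    then show ?case using snoc[OF Suc] by (simp add: replicate_append_same)
  qed (simp add: assms)
qed

section \<open>Existence by lowering the bound on the pole order\<close>

lemma normal_factorization_exists:
  assumes "laurent_isometry p" "\<And>i. i > 0 \<Longrightarrow> endo_coeff p i = (\<lambda>v. 0)"
    and "\<And>i. i < - int d \<Longrightarrow> endo_coeff p i = (\<lambda>v. 0)"
  shows "\<exists>Us h. normal_factorization scale b p Us h \<and> UNIV \<notin> set Us"
  using assms
proof (induction d arbitrary: p)
  case 0
  have "endo_coeff p i = (\<lambda>v. 0)" if "i \<noteq> 0" for i
    using 0(2,3)[of i] that by (cases "i > 0") auto
  note constant_isometry[OF 0(1) this]
  then have "normal_factorization scale b p [] (endo_coeff p 0)"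
    unfolding normal_factorization_Nil by blast
  then show ?case by force
next
  case (Suc d)
  define U where "U = range (endo_coeff p 0)"
  define q where "q = twist 1 U \<circ> p"
  have hom: "module_hom smult_L smult_L p" using Suc.prems(1) by (simp add: laurent_isometry_def)
  interpret l: Vector_Spaces.linear scale scale "endo_coeff p 0" by (rule linear_endo_coeff[OF hom])
  have U: "subspace U" unfolding U_def by (rule l.subspace_image) simp
  have P0: "orth_proj b U 0 = 0" using U by (simp add: orth_proj_id subspace_0)
  have PU: "orth_proj b U (endo_coeff p 0 v) = endo_coeff p 0 v" for v
    by (rule orth_proj_id[OF U]) (simp add: U_def)
  have coeff_q: "endo_coeff q i v = endo_coeff p (i - 1) v - orth_proj b U (endo_coeff p (i - 1) v)
      + orth_proj b U (endo_coeff p i v)" for i v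
    by (simp add: q_def endo_coeff_twist_comp[OF U])
  have p: "p = twist (- 1) U \<circ> q"
    using twist_inverse[OF U, of "- 1"] by (simp add: q_def flip: comp_assoc)
  have "laurent_isometry q"
    unfolding q_def by (rule laurent_isometry_twist_comp[OF U Suc.prems(1)])
  moreover have "endo_coeff q i = (\<lambda>v. 0)" if "i > 0" for i
  proof (cases "i = 1")
    \<comment> \<open>Here the surviving term is \<open>p_0 - pi_U p_0\<close>, which is zero
      because \<open>U\<close> is the image of \<open>p_0\<close>.\<close>
    case True
    then show ?thesis using Suc.prems(2)[of 1] by (intro ext) (simp add: coeff_q PU P0)
  next
    case False
    then show ?thesis
      using that Suc.prems(2)[of i] Suc.prems(2)[of "i - 1"] by (intro ext) (simp add: coeff_q P0)
  qed
  moreover have "endo_coeff q i = (\<lambda>v. 0)" if "i < - int d" for i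
  proof (rule ext)
    fix v
    have "orth_proj b U (endo_coeff p i v) = 0"
    \<comment> \<open>This is the only index below \<open>- int d\<close> at which \<open>p\<close>
      may have a nonzero coefficient.\<close>
    proof (cases "i = - int (Suc d)")
      case True
      have "b (endo_coeff p 0 w) (endo_coeff p i v) = 0" for w
        unfolding True by (rule extreme_coeffs_orthogonal[OF Suc.prems]) auto
      then show ?thesis by (intro orth_proj_of_orth[OF U]) (auto simp: U_def orth_def)
    next
      case False
      then show ?thesis using that Suc.prems(3)[of i] P0 by simp
    qed
    then show "endo_coeff q i v = 0"
      using that Suc.prems(3)[of "i - 1"] P0 by (simp add: coeff_q)
  qed
  ultimately obtain Us h where Us: "normal_factorization scale b q Us h" "UNIV \<notin> set Us"
    using Suc.IH by blast
  show ?case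
  \<comment> \<open>As \<open>Suc d\<close> is only a bound, \<open>p_0\<close> may be onto. The
    factor is then the identity and is omitted, which keeps \<open>UNIV\<close> out of the
    list.\<close>
  proof (cases "U = UNIV")
    case True
    then have "p = q" using p by (simp add: twist_UNIV)
    then show ?thesis using Us by blast
  next
    case False
    have "orth b U + hd Us = UNIV" if "Us \<noteq> []"
    proof -
      have hd: "range (endo_coeff q 0) = hd Us" "subspace (hd Us)"
        using normal_factorization_coeffs(2)[OF Us(1)] Us(1) that
        by (auto simp: normal_factorization_def)
      interpret P: Vector_Spaces.linear scale scale "orth_proj b U" by (rule linear_orth_proj[OF U])
      \<comment> \<open>The constant coefficient of \<open>q\<close> is
        \<open>(1 - pi_U) p_(-1) + pi_U p_0\<close>; projecting to \<open>U\<close> leaves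
        \<open>p_0\<close>. Hence \<open>hd Us\<close>, the image of that coefficient, projects onto
        \<open>U\<close>.\<close>
      have "orth_proj b U (endo_coeff q 0 v) = endo_coeff p 0 v" for v
        by (simp add: coeff_q P.add P.diff PU orth_proj_id[OF U] orth_proj_in[OF U])
      then have "orth_proj b U ` hd Us = U"
        unfolding U_def hd(1)[symmetric] by (simp add: image_image)
      then show ?thesis using orth_proj_image_iff[OF U hd(2)] by simp
    qed
    then have "normal_factorization scale b p (U # Us) h"
      using U p Us(1) by (auto simp: normal_factorization_Cons)
    then show ?thesis using Us(2) False by (intro exI[of _ "U # Us"]) auto
  qed
qed

section \<open>Comparing factorizations of different lengths\<close>

lemma normal_factorization_padded_unique:
  assumes "normal_factorization scale b p Us h" "normal_factorization scale b p Us' h'"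
  shows "h = h' \<and> Us @ replicate (length Us') UNIV = Us' @ replicate (length Us) UNIV"
  \<comment> \<open>Padding each list by the length of the other makes the lengths agree.\<close>
  using normal_factorization_unique[OF _
      normal_factorization_append_UNIV[OF assms(1), of "length Us'"]
      normal_factorization_append_UNIV[OF assms(2), of "length Us"]]
  by simp

lemma normal_factorization_reduced_unique:
  assumes "normal_factorization scale b p Us h" "normal_factorization scale b p Us' h'"
    and "UNIV \<notin> set Us" "UNIV \<notin> set Us'"
  shows "Us = Us'"
proof -
  \<comment> \<open>Filtering removes exactly the padding, since the original lists avoid
    \<open>UNIV\<close>.\<close>
  have "filter (\<lambda>U. U \<noteq> UNIV) (Us @ replicate (length Us') UNIV) = Us"
    "filter (\<lambda>U. U \<noteq> UNIV) (Us' @ replicate (length Us) UNIV) = Us'"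
    using assms(3,4) by (auto simp: filter_id_conv)
  then show ?thesis using normal_factorization_padded_unique[OF assms(1,2)] by simp
qed

end

theorem mainTheorem6:
  fixes scale :: "'k::field \<Rightarrow> 'v::ab_group_add \<Rightarrow> 'v"
    and Basis :: "'v set"
    and b :: "'v \<Rightarrow> 'v \<Rightarrow> 'k"
    and p :: "(int \<Rightarrow>\<^sub>0 'v) \<Rightarrow> (int \<Rightarrow>\<^sub>0 'v)"
  assumes "finite_dimensional_vector_space scale Basis"
    and "symmetric_bilinear_form scale b"
    and "anisotropic b"
    and "p \<in> paraunitary_neg scale b"
  shows "(\<exists>!(Us, h). normal_factorization scale b p Us h \<and> UNIV \<notin> set Us) \<and>
         (\<forall>Us h Us' h'. normal_factorization scale b p Us h \<and> normal_factorization scale b p Us' h' \<longrightarrow>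
            h = h' \<and> (length Us = length Us' \<longrightarrow> Us = Us'))"
proof -
  interpret finite_dimensional_vector_space scale Basis by fact
  interpret anisotropic_space scale Basis b
    using assms by unfold_locales auto
  have p: "laurent_isometry p" "\<And>i. i > 0 \<Longrightarrow> endo_coeff p i = (\<lambda>v. 0)"
    using assms(4) by (auto simp: paraunitary_neg_def paraunitary_group_def laurent_isometry_def)
  obtain d where "\<And>i. i < - int d \<Longrightarrow> endo_coeff p i = (\<lambda>v. 0)"
    using endo_coeff_lower_bound p(1) laurent_isometry_def by blast
  then obtain Us h where Us: "normal_factorization scale b p Us h" "UNIV \<notin> set Us"
    using normal_factorization_exists[OF p] by blast
  have "\<exists>!(Us, h). normal_factorization scale b p Us h \<and> UNIV \<notin> set Us"
  proof (rule ex1I[of _ "(Us, h)"])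
    show "case (Us, h) of (Us, h) \<Rightarrow> normal_factorization scale b p Us h \<and> UNIV \<notin> set Us"
      using Us by simp
  next
    fix z
    assume z: "case z of (Us, h) \<Rightarrow> normal_factorization scale b p Us h \<and> UNIV \<notin> set Us"
    obtain Us' h' where "z = (Us', h')" by (cases z)
    with z Us show "z = (Us, h)"
      using normal_factorization_padded_unique normal_factorization_reduced_unique by auto
  qed
  then show ?thesis
    using normal_factorization_padded_unique normal_factorization_unique by blast
qed

end
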